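(* Let $r\geq 3$ be an integer. For every $\epsilon>0$ and every $\delta>0$, there exists $n_0\in\mathbb N$ such that for all integers $n$ and $k$ with $n>n_0$ and $\frac{r-2}{r-1}+\epsilon<\frac kn<\frac{r-1}r-\epsilon$, we have $$(1-\delta)\binom{n-1}{k-1}\leq M_r(n,k)<\binom{n-1}{k-1}.$$
   Context: Let $[n]=\{1,2,\ldots,n\}$ and $\binom{[n]}{k}=\{F\subset[n]:|F|=k\}$. A family $\mathcal F\subset\binom{[n]}{k}$ is $r$-wise intersecting if $F_1\cap\cdots\cap F_r\neq\emptyset$ for all $F_1,\ldots,F_r\in\mathcal F$ (not necessarily distinct); it is non-trivial if $\bigcap_{F\in\mathcal F}F=\emptyset$. $M_r(n,k)$ denotes the maximum size $|\mathcal F|$ of a non-trivial $r$-wise intersecting family $\mathcal F\subset\binom{[n]}{k}$. *)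

theory Defs
  imports Complex_Main "HOL-Library.Ramsey"
begin

definition wise_intersecting :: "nat \<Rightarrow> 'a set set \<Rightarrow> bool" where
  "wise_intersecting r \<F> \<longleftrightarrow>
     (\<forall>F :: nat \<Rightarrow> 'a set. (\<forall>i\<in>{1..r}. F i \<in> \<F>) \<longrightarrow> (\<Inter>i\<in>{1..r}. F i) \<noteq> {})"

text \<open>The empty family does not count as non-trivial: its intersection is the universe of the type.\<close>

definition nontrivial_family :: "'a set set \<Rightarrow> bool" where
  "nontrivial_family \<F> \<longleftrightarrow> \<Inter>\<F> = {}"

text \<open>If no non-trivial \<open>r\<close>-wise intersecting family of \<open>k\<close>-subsets exists, this is
  the unspecified value \<open>Max {}\<close>.\<close>

definition max_nontrivial :: "nat \<Rightarrow> nat \<Rightarrow> nat \<Rightarrow> nat" where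
  "max_nontrivial r n k =
     Max {card \<F> | \<F>. \<F> \<subseteq> nsets {1..n} k \<and> wise_intersecting r \<F> \<and> nontrivial_family \<F>}"

end

theory Submission
  imports Defs
begin

text \<open>
  Upper bound. Pass to the family \<open>\<G>\<close> of complements, which are \<open>l\<close>-sets with \<open>l = n - k\<close>, no \<open>r\<close> of
  which cover the ground set, and use Katona's cycle method. In a cyclic arrangement, let \<open>S\<close> be the
  set of starting points of the arcs of length \<open>l\<close> that lie in \<open>\<G>\<close>. If \<open>0 \<in> S\<close>, then for each of the
  \<open>l\<close> values \<open>x \<in> {n-l..<n}\<close> the progression \<open>x, x - l, x - 2l, \<dots>\<close> must leave \<open>S\<close>, since otherwise it
  yields \<open>r\<close> arcs that cover the circle; hence \<open>|S| \<le> n - l = k\<close>, and averaging gives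
  \<open>|\<F>| \<le> (n-1 choose k-1)\<close>. In case of equality every cyclic arrangement has exactly \<open>k\<close> arcs in \<open>\<G>\<close>,
  and these are the arcs that avoid one point. Applied to arrangements in which two \<open>l\<close>-sets
  \<open>A \<in> \<G>\<close> and \<open>A - a + a' \<notin> \<G>\<close> are consecutive arcs, this puts every \<open>l\<close>-set with \<open>a\<close> but
  without \<open>a'\<close> into \<open>\<G>\<close>, and then every \<open>l\<close>-set without \<open>a'\<close>; so \<open>\<F>\<close> is trivial.

  Lower bound. For a fixed set \<open>T\<close> of large constant size and \<open>v \<notin> T\<close>, take all \<open>F \<ni> v\<close> that miss
  less than a fraction \<open>1/(r-1)\<close> of \<open>T\<close>, together with all \<open>F \<supseteq> T\<close> that avoid \<open>v\<close>. Since \<open>k/n\<close> exceeds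
  \<open>1 - 1/(r-1)\<close> by a constant, Chebyshev's inequality shows that only a small fraction of the
  \<open>k\<close>-sets through \<open>v\<close> is lost.
\<close>

section \<open>Covering the circle by arcs\<close>

text \<open>A multiple of \<open>n\<close> translates \<open>y\<close> to a point \<open>z\<close>
  with \<open>p 0 \<le> z < p 0 + n\<close>. For the last \<open>i\<close> with
  \<open>p i \<le> z\<close>, the next point (or \<open>p 0 + n\<close> if \<open>i = r - 1\<close>)
  lies beyond \<open>z\<close> and at most \<open>l\<close> past \<open>p i\<close>.\<close>

lemma gaps_cover:
  fixes p :: "nat \<Rightarrow> int" and n l y :: int
  assumes "r > 0" "n > 0"
    and gap: "\<And>i. Suc i < r \<Longrightarrow> p (Suc i) \<le> p i + l"
    and last: "p 0 + n \<le> p (r - 1) + l"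
  shows "\<exists>i<r. (y - p i) mod n < l"
proof -
  define z where "z = p 0 + (y - p 0) mod n"
  have z: "p 0 \<le> z" "z < p 0 + n"
    using assms(2) by (auto simp: z_def)
  define I where "I = {i. i < r \<and> p i \<le> z}"
  have I: "finite I" "0 \<in> I"
    using z assms(1) by (auto simp: I_def)
  define i where "i = Max I"
  have i: "i < r" "p i \<le> z"
    using Max_in[OF I(1)] I(2) unfolding i_def[symmetric] by (auto simp: I_def)
  have "z < p i + l"
  proof (cases "Suc i < r")
    case True
    have "Suc i \<notin> I"
      using Max_ge[OF I(1), of "Suc i"] by (auto simp: i_def)
    with True gap[OF True] show ?thesis
      by (auto simp: I_def)
  next
    case False
    with i have "i = r - 1" by auto
    with z last show ?thesis by auto
  qed
  moreover have "(y - p i) mod n = (z - p i) mod n"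
    unfolding z_def using mod_add_left_eq[of "y - p 0" n "p 0 - p i"] by (simp add: algebra_simps)
  moreover have "(z - p i) mod n \<le> z - p i"
    using i by (intro zmod_le_nonneg_dividend) auto
  ultimately show ?thesis
    using i by (intro exI[of _ i]) auto
qed

text \<open>On the circle of residues modulo \<open>n\<close>, \<open>(y - s) mod n < l\<close> says
  that \<open>y\<close> lies on the arc of length \<open>l\<close> starting at \<open>s\<close>.
  Starts are arbitrary integers, so rotations need no reduction.\<close>

definition uncovered :: "nat \<Rightarrow> int \<Rightarrow> int \<Rightarrow> (int \<Rightarrow> bool) \<Rightarrow> bool" where
  "uncovered r n l S \<longleftrightarrow>
     (\<forall>p :: nat \<Rightarrow> int. (\<forall>i<r. S (p i)) \<longrightarrow> (\<exists>y. \<forall>i<r. \<not> (y - p i) mod n < l))"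

lemma not_uncoveredI:
  fixes p :: "nat \<Rightarrow> int" and n l :: int
  assumes "uncovered r n l S" "r > 0" "n > 0"
    and "\<And>i. Suc i < r \<Longrightarrow> p (Suc i) \<le> p i + l"
    and "p 0 + n \<le> p (r - 1) + l"
    and "\<And>i. i < r \<Longrightarrow> S (p i)"
  shows False
proof -
  from assms(1,6) obtain y where "\<forall>i<r. \<not> (y - p i) mod n < l"
    unfolding uncovered_def by meson
  moreover have "\<exists>i<r. (y - p i) mod n < l"
    by (rule gaps_cover) (use assms(2-5) in auto)
  ultimately show False by blast
qed

text \<open>The points \<open>max 0 (x - j l)\<close> for \<open>j < r\<close> have consecutive gaps at most \<open>l\<close>, also across \<open>n\<close>.\<close>

lemma class_missing:
  fixes n l x :: int
  assumes "uncovered r n l S" "r > 0" "n > 0" "l > 0" "n \<le> int r * l" "S 0" "n - l \<le> x"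
  shows "\<exists>j<r. 0 < x - int j * l \<and> \<not> S (x - int j * l)"
proof (rule ccontr)
  assume "\<not> ?thesis"
  hence *: "S (x - int j * l)" if "j < r" "0 < x - int j * l" for j
    using that by blast
  define p where "p = (\<lambda>i. max 0 (x - int (r - 1 - i) * l))"
  have "S (p i)" if "i < r" for i
  proof (cases "x - int (r - 1 - i) * l \<le> 0")
    case False
    with *[of "r - 1 - i"] that show ?thesis
      unfolding p_def by (simp add: max_def del: of_nat_diff)
  qed (use assms(6) in \<open>simp add: p_def\<close>)
  moreover have "p (Suc i) \<le> p i + l" if "Suc i < r" for i
  proof -
    have "int (r - 1 - i) = int (r - 1 - Suc i) + 1"
      using that by auto
    thus ?thesis
      using assms(4) unfolding p_def by (simp add: algebra_simps max_def)
  qed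
  \<comment> \<open>If \<open>p 0 = 0\<close>, this follows from \<open>n - l \<le> x\<close>,
    otherwise from \<open>n \<le> r l\<close>.\<close>
  moreover have "p 0 + n \<le> p (r - 1) + l"
    using assms(2,5,7) by (auto simp: p_def max_def of_nat_diff algebra_simps)
  ultimately show False
    using not_uncoveredI[OF assms(1-3), of p] by blast
qed

text \<open>One missing point is chosen on each progression \<open>x, x - l, ...\<close> with
  \<open>x\<close> in \<open>{n-l..<n}\<close>. These \<open>l\<close> values of \<open>x\<close>
  are pairwise incongruent modulo \<open>l\<close>, so the choices are distinct.\<close>

lemma obtain_missing:
  fixes n l :: int
  assumes "uncovered r n l S" "r > 0" "n > 0" "l > 0" "l \<le> n" "n \<le> int r * l" "S 0"
  obtains m where "\<And>x. x \<in> {n-l..<n} \<Longrightarrow> \<exists>j<r. m x = x - int j * l"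
    and "m ` {n-l..<n} \<subseteq> {x\<in>{0..<n}. \<not> S x}"
    and "inj_on m {n-l..<n}"
proof -
  have "\<forall>x\<in>{n-l..<n}. \<exists>y. (\<exists>j<r. y = x - int j * l) \<and> 0 < y \<and> \<not> S y"
    using class_missing[OF assms(1-4,6,7)] by (metis atLeastLessThan_iff)
  then obtain m where m:
      "\<And>x. x \<in> {n-l..<n} \<Longrightarrow> (\<exists>j<r. m x = x - int j * l) \<and> 0 < m x \<and> \<not> S (m x)"
    by metis
  have "m x < n" if "x \<in> {n-l..<n}" for x
  proof -
    from m[OF that] obtain j where "m x = x - int j * l" by blast
    moreover have "0 \<le> int j * l" using assms(4) by simp
    moreover have "x < n" using that by simp
    ultimately show ?thesis by linarith
  qed
  moreover have "inj_on m {n-l..<n}"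
  proof (rule inj_onI)
    fix x y assume x: "x \<in> {n-l..<n}" and y: "y \<in> {n-l..<n}" and eq: "m x = m y"
    obtain i j where "m x = x - int i * l" "m y = y - int j * l"
      using m[OF x] m[OF y] by blast
    with eq have "x - y = (int i - int j) * l"
      by (simp add: algebra_simps)
    hence "l dvd x - y" by simp
    moreover have "\<bar>x - y\<bar> < l" using x y by auto
    ultimately have "x - y = 0"
      using dvd_imp_le_int[of "x - y" l] assms(4) by fastforce
    thus "x = y" by simp
  qed
  ultimately show ?thesis
    using m that[of m] by (force simp: image_subset_iff less_imp_le)
qed

lemma card_missing_ge:
  fixes n l :: int
  assumes "uncovered r n l S" "r > 0" "n > 0" "l > 0" "l \<le> n" "n \<le> int r * l" "S 0"
  shows "nat l \<le> card {x\<in>{0..<n}. \<not> S x}"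
proof -
  obtain m where m: "m ` {n-l..<n} \<subseteq> {x\<in>{0..<n}. \<not> S x}" "inj_on m {n-l..<n}"
    using obtain_missing[OF assms] by metis
  have "card {n-l..<n} \<le> card {x\<in>{0..<n}. \<not> S x}"
    by (rule card_inj_on_le[OF m(2,1)]) (auto intro: finite_subset[of _ "{0..<n}"])
  thus ?thesis by simp
qed

text \<open>
  With exactly \<open>l\<close> missing points, each residue class contains exactly one of them. If \<open>x + 1\<close> is
  missing but \<open>x\<close> is not, then the class of \<open>x + 1\<close> with its largest element replaced by \<open>x\<close> still
  covers the circle.
\<close>

lemma missing_interval:
  fixes n l :: int
  assumes "uncovered r n l S" "r > 1" "n > 0" "l > 0" "l \<le> n" "n < int r * l" "S 0"
    and "\<not> S (n - 1)" and card: "card {x\<in>{0..<n}. \<not> S x} = nat l"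
  shows "{x\<in>{0..<n}. \<not> S x} = {n-l..<n}"
proof -
  let ?M = "{x\<in>{0..<n}. \<not> S x}"
  have finite_M: "finite ?M" by (rule finite_subset[of _ "{0..<n}"]) auto
  obtain m where m: "\<And>x. x \<in> {n-l..<n} \<Longrightarrow> \<exists>j<r. m x = x - int j * l"
      "m ` {n-l..<n} \<subseteq> ?M" "inj_on m {n-l..<n}"
    by (rule obtain_missing[OF assms(1) _ assms(3-5) _ assms(7)]) (use assms(2,6) in auto)
  \<comment> \<open>There are only \<open>l\<close> missing points, so the injective choice
    \<open>m\<close> uses all of them.\<close>
  have onto: "m ` {n-l..<n} = ?M"
    using m(2,3) card finite_M by (intro card_subset_eq) (simp_all add: card_image)
  have unique: "y = z" if "x \<in> {n-l..<n}" "y \<in> ?M" "z \<in> ?M" "l dvd x - y" "l dvd x - z" for x y z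
  proof -
    have *: "u = m x" if "u \<in> ?M" "l dvd x - u" for u
    proof -
      from onto \<open>u \<in> ?M\<close> obtain w where w: "w \<in> {n-l..<n}" "u = m w" by blast
      from m(1)[OF w(1)] w(2) have "l dvd w - u" by auto
      with \<open>l dvd x - u\<close> have "l dvd x - w"
        using dvd_diff[of l "x - u" "w - u"] by simp
      moreover have "\<bar>x - w\<bar> < l" using w(1) \<open>x \<in> {n-l..<n}\<close> by auto
      ultimately have "x - w = 0"
        using dvd_imp_le_int[of "x - w" l] assms(4) by fastforce
      with w(2) show ?thesis by simp
    qed
    from *[of y] *[of z] that show ?thesis by simp
  qed
  \<comment> \<open>Induction downwards from the missing point \<open>n - 1\<close>: a missing
    \<open>x + 1\<close> forces \<open>x\<close> to be missing, as long as
    \<open>x \<ge> n - l\<close>.\<close>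
  have "\<not> S (n - 1 - int d)" if "int d < l" for d
    using that
  proof (induction d)
    case 0
    then show ?case using assms(8) by simp
  next
    case (Suc d)
    define x where "x = n - 1 - int (Suc d)"
    have x: "n - l \<le> x" "x + 1 < n" "0 \<le> x"
      using Suc.prems assms(5) by (auto simp: x_def)
    have x1_eq: "x + 1 = n - 1 - int d" by (simp add: x_def)
    have "\<not> S (x + 1)" unfolding x1_eq using Suc by simp
    hence x1: "x + 1 \<in> ?M" using x by auto
    show ?case
    proof
      assume "S (n - 1 - int (Suc d))"
      hence Sx: "S x" by (simp add: x_def)
      define p where "p = (\<lambda>i. if i = r - 1 then x else max 0 (x + 1 - int (r - 1 - i) * l))"
      have "S (p i)" if "i < r" for i
      proof (cases "i = r - 1 \<or> x + 1 - int (r - 1 - i) * l \<le> 0")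
        case True
        then show ?thesis using Sx assms(7) by (auto simp: p_def)
      next
        case False
        define y where "y = x + 1 - int (r - 1 - i) * l"
        have "0 < r - 1 - i" using False that by auto
        hence "0 < int (r - 1 - i) * l" using assms(4) by (intro mult_pos_pos) simp_all
        hence y: "0 < y" "y < x + 1" using False unfolding y_def by linarith+
        have "S y"
        proof (rule ccontr)
          assume "\<not> S y"
          hence "y \<in> ?M" using x y by simp
          moreover have "l dvd x + 1 - y" by (simp add: y_def del: of_nat_diff)
          ultimately have "y = x + 1" using unique[of "x + 1" y "x + 1"] x1 x by simp
          with y show False by simp
        qed
        thus ?thesis using False y unfolding p_def y_def by (simp del: of_nat_diff)
      qed
      moreover have "p (Suc i) \<le> p i + l" if "Suc i < r" for i
      proof -
        define u where "u = int (r - 1 - Suc i) * l"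
        have "int (r - 1 - i) = int (r - 1 - Suc i) + 1"
          using that by linarith
        hence "int (r - 1 - i) * l = u + l" by (simp only: u_def distrib_right mult_1_left)
        moreover have "i \<noteq> r - 1" using that by linarith
        ultimately have "p i = max 0 (x + 1 - (u + l))" by (simp only: p_def if_False)
        moreover have "p (Suc i) \<le> max 0 (x + 1 - u)"
          using that x by (cases "Suc i = r - 1") (simp_all add: p_def u_def)
        ultimately show ?thesis using assms(4) by linarith
      qed
      \<comment> \<open>Lowering the top point from \<open>x + 1\<close> to \<open>x\<close> costs
        one unit, which the strict inequality \<open>n < r l\<close> provides.\<close>
      moreover have "p 0 + n \<le> p (r - 1) + l"
      proof -
        have "int (r - 1) = int r - 1" using assms(2) by linarith
        hence "p 0 = max 0 (x + 1 - (int r * l - l))"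
          using assms(2) by (simp add: p_def left_diff_distrib)
        moreover have "p (r - 1) = x" by (simp add: p_def)
        ultimately show ?thesis using x assms(6) by linarith
      qed
      ultimately show False
        using not_uncoveredI[OF assms(1) _ assms(3), of p] assms(2) by (meson less_trans zero_less_one)
    qed
  qed
  hence "\<not> S x" if "x \<in> {n-l..<n}" for x
    using that \<open>\<And>d. int d < l \<Longrightarrow> \<not> S (n - 1 - int d)\<close>[of "nat (n - 1 - x)"] by auto
  hence "{n-l..<n} \<subseteq> ?M" using assms(5) by auto
  thus ?thesis
    using card finite_M by (intro card_subset_eq[symmetric]) simp_all
qed

section \<open>Averaging over arrangements\<close>

lemma card_nsets_choose:
  assumes "finite A"
  shows "card (nsets A k) = card A choose k"
proof -
  have "nsets A k = {B. B \<subseteq> A \<and> card B = k}"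
    using assms by (auto simp: nsets_def finite_subset)
  thus ?thesis by (simp add: n_subsets[OF assms])
qed

text \<open>Values outside \<open>{..<n}\<close> are fixed by \<open>\<rightarrow>\<^sub>E\<close>,
  which makes the set finite and lets arrangements be counted as functions. A cyclic arrangement is
  represented by all of its rotations.\<close>

definition arrangements :: "nat \<Rightarrow> 'a set \<Rightarrow> (nat \<Rightarrow> 'a) set" where
  "arrangements n V = {f \<in> {..<n} \<rightarrow>\<^sub>E V. bij_betw f {..<n} V}"

lemma finite_arrangements: "finite V \<Longrightarrow> finite (arrangements n V)"
  unfolding arrangements_def by (rule finite_subset[OF _ finite_PiE[of "{..<n}" "\<lambda>_. V"]]) auto

lemma arrangement_of_list:
  assumes "distinct xs"
  shows "restrict ((!) xs) {..<length xs} \<in> arrangements (length xs) (set xs)"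
  using bij_betw_nth[OF assms refl refl]
  by (simp add: arrangements_def bij_betw_def restrict_PiE_iff)

text \<open>The symmetric group acts transitively on subsets of a given size: a bijection of the
  sets is glued to one of their complements.\<close>

lemma bij_betw_carrying:
  assumes "finite V" "B \<subseteq> V" "C \<subseteq> V" "card B = card C"
  obtains \<sigma> where "bij_betw \<sigma> V V" "\<sigma> ` B = C"
proof -
  have fin: "finite B" "finite C" using assms finite_subset by blast+
  then obtain g where g: "bij_betw g B C"
    using assms(4) by (metis finite_same_card_bij)
  have "card (V - B) = card (V - C)"
    using assms fin by (simp add: card_Diff_subset)
  then obtain h where h: "bij_betw h (V - B) (V - C)"
    using assms(1) by (metis finite_same_card_bij finite_Diff)
  let ?\<sigma> = "\<lambda>x. if x \<in> B then g x else h x"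
  have "bij_betw ?\<sigma> (B \<union> (V - B)) (C \<union> (V - C))"
    by (rule bij_betw_disjoint_Un[OF g h]) auto
  moreover have "?\<sigma> ` B = C"
    using g by (auto simp: bij_betw_def)
  ultimately show ?thesis
    using assms that[of ?\<sigma>] by (simp add: Un_absorb1)
qed

text \<open>Composition with a permutation carrying \<open>B\<close> to \<open>C\<close> is an
  injection; \<open>restrict\<close> keeps the composite extensional. Swapping \<open>B\<close> and
  \<open>C\<close> will give equality.\<close>

lemma card_arrangements_image_le:
  assumes "finite V" "I \<subseteq> {..<n}" "B \<in> nsets V l" "C \<in> nsets V l"
  shows "card {f \<in> arrangements n V. f ` I = B} \<le> card {f \<in> arrangements n V. f ` I = C}"
proof -
  from assms obtain \<sigma> where \<sigma>: "bij_betw \<sigma> V V" "\<sigma> ` B = C"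
    using bij_betw_carrying[of V B C] by (auto simp: nsets_def)
  define \<Phi> where "\<Phi> = (\<lambda>f. restrict (\<sigma> \<circ> f) {..<n})"
  have "inj_on \<Phi> {f \<in> arrangements n V. f ` I = B}"
  proof (rule inj_onI)
    fix f g assume f: "f \<in> {f \<in> arrangements n V. f ` I = B}"
      and g: "g \<in> {f \<in> arrangements n V. f ` I = B}" and eq: "\<Phi> f = \<Phi> g"
    have fg: "f \<in> {..<n} \<rightarrow>\<^sub>E V" "g \<in> {..<n} \<rightarrow>\<^sub>E V"
      using f g by (auto simp: arrangements_def)
    show "f = g"
    proof (rule PiE_ext[OF fg])
      fix i assume i: "i \<in> {..<n}"
      hence "\<sigma> (f i) = \<sigma> (g i)" using fun_cong[OF eq, of i] by (simp add: \<Phi>_def)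
      thus "f i = g i"
        using \<sigma>(1) fg i by (auto simp: bij_betw_def dest: inj_onD)
    qed
  qed
  moreover have "\<Phi> ` {f \<in> arrangements n V. f ` I = B} \<subseteq> {f \<in> arrangements n V. f ` I = C}"
  proof clarify
    fix f assume f: "f \<in> arrangements n V" "B = f ` I"
    hence bij: "bij_betw f {..<n} V" by (auto simp: arrangements_def)
    have "bij_betw (\<Phi> f) {..<n} V"
      using bij_betw_trans[OF bij \<sigma>(1)] bij_betw_cong[of "{..<n}" "\<Phi> f" "\<sigma> \<circ> f" V]
      by (simp add: \<Phi>_def)
    moreover from this have "\<Phi> f \<in> {..<n} \<rightarrow>\<^sub>E V"
      by (auto simp: \<Phi>_def bij_betw_def)
    moreover have "\<Phi> f ` I = \<sigma> ` (f ` I)"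
      using assms(2) unfolding \<Phi>_def image_image by (intro image_cong) auto
    ultimately show "\<Phi> f \<in> arrangements n V \<and> \<Phi> f ` I = C"
      using f \<sigma>(2) by (auto simp: arrangements_def)
  qed
  ultimately show ?thesis
    using finite_arrangements[OF assms(1)] by (intro card_inj_on_le) auto
qed

text \<open>By symmetry, a random arrangement sends \<open>I\<close> to a uniformly distributed
  \<open>l\<close>-subset of \<open>V\<close>. The multiplied form stays within the natural
  numbers.\<close>

lemma card_arrangements_image:
  assumes "finite V" "card V = n" "I \<subseteq> {..<n}" "card I = l" "B \<in> nsets V l"
  shows "card {f \<in> arrangements n V. f ` I = B} * (n choose l) = card (arrangements n V)"
proof -
  have "arrangements n V = (\<Union>C\<in>nsets V l. {f \<in> arrangements n V. f ` I = C})"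
  proof (intro equalityI subsetI)
    fix f assume f: "f \<in> arrangements n V"
    hence "inj_on f I" "f ` I \<subseteq> V"
      using assms(3) by (auto simp: arrangements_def bij_betw_def intro: inj_on_subset)
    hence "f ` I \<in> nsets V l"
      using assms finite_subset[of I] by (auto simp: nsets_def card_image)
    thus "f \<in> (\<Union>C\<in>nsets V l. {f \<in> arrangements n V. f ` I = C})" using f by auto
  qed auto
  hence "card (arrangements n V) = card (\<Union>C\<in>nsets V l. {f \<in> arrangements n V. f ` I = C})"
    by simp
  also have "\<dots> = (\<Sum>C\<in>nsets V l. card {f \<in> arrangements n V. f ` I = C})"
    using assms(1) by (intro card_UN_disjoint) (auto simp: finite_imp_finite_nsets finite_arrangements)
  also have "\<dots> = (\<Sum>C\<in>nsets V l. card {f \<in> arrangements n V. f ` I = B})"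
    using card_arrangements_image_le[OF assms(1,3)] assms(5) by (intro sum.cong) (auto intro: antisym)
  also have "\<dots> = card {f \<in> arrangements n V. f ` I = B} * (n choose l)"
    using assms(1,2) by (simp add: card_nsets_choose)
  finally show ?thesis by simp
qed

section \<open>Arcs of positions and their images in the ground set\<close>

text \<open>Positions are naturals below \<open>n\<close>, the domain of arrangements, while starts
  are integers, so that arcs can be rotated freely.\<close>

definition arc :: "nat \<Rightarrow> nat \<Rightarrow> int \<Rightarrow> nat set" where
  "arc n l s = {y. y < n \<and> (int y - s) mod int n < int l}"

lemma arc_subset: "arc n l s \<subseteq> {..<n}"
  by (auto simp: arc_def)

lemma arc_mod: "arc n l (s mod int n) = arc n l s"
  unfolding arc_def mod_diff_right_eq ..

lemma card_arc:
  assumes "l \<le> n" "n > 0"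
  shows "card (arc n l s) = l"
proof -
  define g where "g = (\<lambda>j. nat ((s + int j) mod int n))"
  have int_g: "int (g j) = (s + int j) mod int n" for j
    using assms by (simp add: g_def)
  have offset: "(int (g j) - s) mod int n = int j" if "j < l" for j
  proof -
    have "(int (g j) - s) mod int n = (s + int j - s) mod int n"
      unfolding int_g by (rule mod_diff_left_eq)
    thus ?thesis using that assms by simp
  qed
  have "bij_betw g {..<l} (arc n l s)"
  proof (rule bij_betw_imageI)
    show "inj_on g {..<l}"
      by (rule inj_onI) (metis offset lessThan_iff of_nat_eq_iff)
    show "g ` {..<l} = arc n l s"
    proof (intro equalityI subsetI)
      fix y assume "y \<in> g ` {..<l}"
      then obtain j where j: "j < l" "y = g j" by auto
      have "int (g j) < int n" using assms by (simp add: int_g)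
      with offset[OF j(1)] j show "y \<in> arc n l s" by (auto simp: arc_def)
    next
      fix y assume y: "y \<in> arc n l s"
      define j where "j = nat ((int y - s) mod int n)"
      have int_j: "int j = (int y - s) mod int n" using assms by (simp add: j_def)
      have "int (g j) = (s + (int y - s)) mod int n"
        unfolding int_g int_j by (rule mod_add_right_eq)
      also have "\<dots> = int y" using y by (simp add: arc_def)
      finally have "y = g j" by simp
      moreover have "j < l" using y int_j by (simp add: arc_def)
      ultimately show "y \<in> g ` {..<l}" by auto
    qed
  qed
  thus ?thesis by (metis bij_betw_same_card card_lessThan)
qed

lemma arc_eq_interval:
  assumes "i + l \<le> n"
  shows "arc n l (int i) = {i..<i+l}"
proof -
  have "(int y - int i) mod int n < int l \<longleftrightarrow> y \<in> {i..<i+l}" if "y < n" for y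
  proof (cases "i \<le> y")
    case True
    then show ?thesis using that by auto
  next
    case False
    have "(int y - int i) mod int n = (int y - int i + int n) mod int n" by simp
    also have "\<dots> = int y - int i + int n"
      using that False assms by (intro mod_pos_pos_trivial) auto
    finally show ?thesis using False assms by auto
  qed
  thus ?thesis using assms by (auto simp: arc_def)
qed

text \<open>This is the cyclic predecessor of the arc \<open>{..<l}\<close>: position
  \<open>l - 1\<close> is exchanged for \<open>n - 1\<close>.\<close>

lemma arc_last:
  assumes "0 < l" "l < n"
  shows "arc n l (int n - 1) = insert (n - 1) {..<l-1}"
proof -
  have "(int y - (int n - 1)) mod int n < int l \<longleftrightarrow> y = n - 1 \<or> y < l - 1" if "y < n" for y
  proof (cases "y = n - 1")
    case True
    have "int (n - 1) = int n - 1" using assms by linarith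
    then show ?thesis using True assms by simp
  next
    case False
    have "(int y - (int n - 1)) mod int n = (int y - (int n - 1) + int n) mod int n"
      by (rule mod_add_self2[symmetric])
    also have "int y - (int n - 1) + int n = int y + 1" by simp
    also have "(int y + 1) mod int n = int y + 1"
      using that False by (intro mod_pos_pos_trivial) auto
    finally show ?thesis using False assms by auto
  qed
  thus ?thesis using assms by (auto simp: arc_def)
qed

text \<open>The form that being \<open>r\<close>-wise intersecting takes for the complements:
  \<open>r\<close> sets have a common point in \<open>V\<close> iff their complements do not cover
  \<open>V\<close>.\<close>

definition cover_free :: "nat \<Rightarrow> 'a set \<Rightarrow> 'a set set \<Rightarrow> bool" where
  "cover_free r V \<G> \<longleftrightarrow> (\<forall>H :: nat \<Rightarrow> 'a set. (\<forall>i<r. H i \<in> \<G>) \<longrightarrow> \<not> V \<subseteq> (\<Union>i<r. H i))"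

text \<open>As \<open>f\<close> is onto \<open>V\<close>, a point outside the \<open>r\<close>
  images is \<open>f y\<close> for some position \<open>y\<close>, and \<open>y\<close> is outside
  the \<open>r\<close> arcs.\<close>

lemma uncovered_arcs:
  assumes "cover_free r V \<G>" "f \<in> arrangements n V"
  shows "uncovered r (int n) (int l) (\<lambda>s. f ` arc n l s \<in> \<G>)"
  unfolding uncovered_def
proof (intro allI impI)
  fix p :: "nat \<Rightarrow> int" assume "\<forall>i<r. f ` arc n l (p i) \<in> \<G>"
  hence "\<not> V \<subseteq> (\<Union>i<r. f ` arc n l (p i))"
    by (rule assms(1)[unfolded cover_free_def, THEN spec[of _ "\<lambda>i. f ` arc n l (p i)"], THEN mp])
  then obtain v where v: "v \<in> V" "\<forall>i<r. v \<notin> f ` arc n l (p i)"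
    by blast
  from assms(2) v(1) obtain y where y: "y < n" "v = f y"
    by (auto simp: arrangements_def bij_betw_def)
  with v(2) have "\<forall>i<r. \<not> (int y - p i) mod int n < int l"
    by (auto simp: arc_def)
  thus "\<exists>y. \<forall>i<r. \<not> (y - p i) mod int n < int l" ..
qed

text \<open>Rotation brings an arbitrary member of \<open>S\<close> to \<open>0\<close>, where the
  bounds on missing points apply.\<close>

lemma uncovered_shift:
  assumes "uncovered r n l S"
  shows "uncovered r n l (\<lambda>x. S (x + c))"
  unfolding uncovered_def
proof (intro allI impI)
  fix p :: "nat \<Rightarrow> int" assume "\<forall>i<r. S (p i + c)"
  with assms[unfolded uncovered_def, rule_format, of "\<lambda>i. p i + c"]
  obtain y where "\<forall>i<r. \<not> (y - (p i + c)) mod n < l" by blast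
  thus "\<exists>y. \<forall>i<r. \<not> (y - p i) mod n < l"
    by (intro exI[of _ "y - c"]) (simp add: algebra_simps)
qed

section \<open>Counting the arcs that lie in a family\<close>

lemma card_periodic_shift:
  fixes n c :: int
  assumes "n > 0" and per: "\<And>x. P (x mod n) \<longleftrightarrow> P x"
  shows "card {x\<in>{0..<n}. P (x + c)} = card {x\<in>{0..<n}. P x}"
proof -
  have "bij_betw (\<lambda>x. (x + c) mod n) {x\<in>{0..<n}. P (x + c)} {x\<in>{0..<n}. P x}"
  proof (rule bij_betw_byWitness[where f' = "\<lambda>x. (x - c) mod n"])
    show "\<forall>x\<in>{x\<in>{0..<n}. P (x + c)}. ((x + c) mod n - c) mod n = x"
      by (auto simp: mod_diff_left_eq)
    show "\<forall>x\<in>{x\<in>{0..<n}. P x}. ((x - c) mod n + c) mod n = x"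
      by (auto simp: mod_add_left_eq)
    show "(\<lambda>x. (x + c) mod n) ` {x\<in>{0..<n}. P (x + c)} \<subseteq> {x\<in>{0..<n}. P x}"
      using assms by auto
    have "P ((x - c) mod n + c) \<longleftrightarrow> P x" for x
      using per[of "(x - c) mod n + c"] per[of x] by (simp add: mod_add_left_eq)
    thus "(\<lambda>x. (x - c) mod n) ` {x\<in>{0..<n}. P x} \<subseteq> {x\<in>{0..<n}. P (x + c)}"
      using assms(1) by auto
  qed
  thus ?thesis by (rule bij_betw_same_card)
qed

lemma card_complement_interval:
  fixes n :: int
  assumes "n \<ge> 0"
  shows "card {x\<in>{0..<n}. S x} + card {x\<in>{0..<n}. \<not> S x} = nat n"
proof -
  have "card {x\<in>{0..<n}. S x} + card {x\<in>{0..<n}. \<not> S x}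
      = card ({x\<in>{0..<n}. S x} \<union> {x\<in>{0..<n}. \<not> S x})"
    by (rule card_Un_disjoint[symmetric]) (auto intro: finite_subset[of _ "{0..<n}"])
  also have "{x\<in>{0..<n}. S x} \<union> {x\<in>{0..<n}. \<not> S x} = {0..<n}" by auto
  finally show ?thesis by simp
qed

text \<open>If \<open>S\<close> has a member, it is rotated to \<open>0\<close>, where
  \<open>l\<close> missing points are known; periodicity carries their number back.\<close>

lemma card_starts_le:
  fixes n l :: int
  assumes "uncovered r n l S" "r > 0" "n > 0" "l > 0" "l \<le> n" "n \<le> int r * l"
    and per: "\<And>x. S (x mod n) \<longleftrightarrow> S x"
  shows "card {x\<in>{0..<n}. S x} \<le> nat (n - l)"
proof (cases "\<exists>c. S c")
  case True
  then obtain c where c: "S c" ..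
  have "nat l \<le> card {x\<in>{0..<n}. \<not> S (x + c)}"
    using card_missing_ge[OF uncovered_shift[OF assms(1)] assms(2-6), of c] c by simp
  also have "\<dots> = card {x\<in>{0..<n}. \<not> S x}"
    using card_periodic_shift[of n "\<lambda>x. \<not> S x" c] assms(3) per by simp
  finally show ?thesis
    using card_complement_interval[of n S] assms(3,4,5) by linarith
qed simp

definition starts :: "nat \<Rightarrow> nat \<Rightarrow> 'a set set \<Rightarrow> (nat \<Rightarrow> 'a) \<Rightarrow> int set" where
  "starts n l \<G> f = {s\<in>{0..<int n}. f ` arc n l s \<in> \<G>}"

lemma card_starts_arrangement_le:
  assumes "cover_free r V \<G>" "f \<in> arrangements n V" "r > 0" "0 < l" "l < n" "n \<le> r * l"
  shows "card (starts n l \<G> f) \<le> n - l"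
proof -
  have "int n \<le> int r * int l" using assms(6) by (metis of_nat_le_iff of_nat_mult)
  hence "card (starts n l \<G> f) \<le> nat (int n - int l)"
    unfolding starts_def using assms
    by (intro card_starts_le[OF uncovered_arcs[OF assms(1,2)]]) (auto simp: arc_mod)
  thus ?thesis using assms by (simp add: nat_diff_distrib)
qed

text \<open>Double counting of pairs of an arrangement and a start: for each of the \<open>n\<close>
  starts, the arc is mapped to a uniformly distributed \<open>l\<close>-set.\<close>

lemma sum_card_starts:
  assumes "finite V" "card V = n" "\<G> \<subseteq> nsets V l" "0 < n" "l \<le> n"
  shows "(\<Sum>f\<in>arrangements n V. card (starts n l \<G> f)) * (n choose l)
           = n * card \<G> * card (arrangements n V)"
proof -
  let ?P = "arrangements n V"
  have fin: "finite ?P" "finite \<G>"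
    using assms by (auto simp: finite_arrangements intro: finite_subset finite_imp_finite_nsets)
  have arc: "card {f \<in> ?P. f ` arc n l s \<in> \<G>} * (n choose l) = card \<G> * card ?P" for s
  proof -
    have "{f \<in> ?P. f ` arc n l s \<in> \<G>} = (\<Union>B\<in>\<G>. {f \<in> ?P. f ` arc n l s = B})" by auto
    hence "card {f \<in> ?P. f ` arc n l s \<in> \<G>} = card (\<Union>B\<in>\<G>. {f \<in> ?P. f ` arc n l s = B})"
      by simp
    also have "\<dots> = (\<Sum>B\<in>\<G>. card {f \<in> ?P. f ` arc n l s = B})"
      using fin by (intro card_UN_disjoint) auto
    finally have "card {f \<in> ?P. f ` arc n l s \<in> \<G>} * (n choose l)
        = (\<Sum>B\<in>\<G>. card {f \<in> ?P. f ` arc n l s = B} * (n choose l))"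
      by (simp add: sum_distrib_right)
    also have "\<dots> = (\<Sum>B\<in>\<G>. card ?P)"
      using assms by (intro sum.cong card_arrangements_image) (auto simp: arc_subset card_arc)
    finally show ?thesis by simp
  qed
  have "(\<Sum>f\<in>?P. card (starts n l \<G> f)) = (\<Sum>f\<in>?P. \<Sum>s\<in>{0..<int n}. of_bool (f ` arc n l s \<in> \<G>))"
    by (simp add: starts_def Int_def)
  also have "\<dots> = (\<Sum>s\<in>{0..<int n}. \<Sum>f\<in>?P. of_bool (f ` arc n l s \<in> \<G>))"
    by (rule sum.swap)
  also have "\<dots> = (\<Sum>s\<in>{0..<int n}. card {f \<in> ?P. f ` arc n l s \<in> \<G>})"
    using fin by (simp add: Int_def)
  finally have "(\<Sum>f\<in>?P. card (starts n l \<G> f)) * (n choose l)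
      = (\<Sum>s\<in>{0..<int n}. card {f \<in> ?P. f ` arc n l s \<in> \<G>} * (n choose l))"
    by (simp add: sum_distrib_right)
  also have "\<dots> = n * card \<G> * card ?P" by (simp add: arc)
  finally show ?thesis .
qed

lemma arrangements_nonempty:
  assumes "finite V" "card V = n"
  shows "arrangements n V \<noteq> {}"
proof -
  from assms obtain xs where "distinct xs" "set xs = V" "length xs = n"
    by (metis finite_distinct_list distinct_card)
  with arrangement_of_list[of xs] show ?thesis by auto
qed

text \<open>Each arrangement contributes at most \<open>n - l\<close>, while
  \<open>(n - l) * (n choose l) = n * ((n - 1) choose l)\<close> makes the average at least
  \<open>n - l\<close>. Hence no arrangement contributes less.\<close>

lemma card_starts_extremal:
  assumes "finite V" "card V = n" "\<G> \<subseteq> nsets V l" "cover_free r V \<G>"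
    and "r > 0" "0 < l" "l < n" "n \<le> r * l"
    and large: "(n - 1) choose l \<le> card \<G>" and f: "f \<in> arrangements n V"
  shows "card (starts n l \<G> f) = n - l"
proof (rule ccontr)
  let ?P = "arrangements n V"
  assume "card (starts n l \<G> f) \<noteq> n - l"
  with card_starts_arrangement_le[OF assms(4) f assms(5-8)]
  have less: "card (starts n l \<G> f) < n - l" by simp
  have "n * card \<G> * card ?P = (\<Sum>f\<in>?P. card (starts n l \<G> f)) * (n choose l)"
    using sum_card_starts[of V n \<G> l] assms by simp
  also have "\<dots> < (\<Sum>f\<in>?P. n - l) * (n choose l)"
  proof (rule mult_strict_right_mono)
    show "(\<Sum>f\<in>?P. card (starts n l \<G> f)) < (\<Sum>f\<in>?P. n - l)"
      using card_starts_arrangement_le[OF assms(4) _ assms(5-8)] f less assms(1)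
      by (intro sum_strict_mono_ex1 finite_arrangements) auto
  qed (use assms in simp)
  also have "\<dots> = card ?P * (n * ((n - 1) choose l))"
    by (simp add: binomial_absorb_comp)
  also have "\<dots> \<le> card ?P * (n * card \<G>)"
    using large by simp
  finally show False by (simp add: mult_ac)
qed

text \<open>The two membership assumptions say that \<open>0\<close> is a start in the family and
  its predecessor \<open>n - 1\<close> is not, so \<open>missing_interval\<close> places the missing
  starts at the last \<open>l\<close> positions.\<close>

lemma starts_extremal_interval:
  assumes "cover_free r V \<G>" "f \<in> arrangements n V" "card (starts n l \<G> f) = n - l"
    and "r > 1" "0 < l" "l < n" "n < r * l"
    and "f ` {..<l} \<in> \<G>" "f ` insert (n - 1) {..<l-1} \<notin> \<G>" "i + l < n"
  shows "f ` {i..<i+l} \<in> \<G>"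
proof -
  define S where "S = (\<lambda>s. f ` arc n l s \<in> \<G>)"
  have "card {s\<in>{0..<int n}. S s} + card {s\<in>{0..<int n}. \<not> S s} = n"
    using card_complement_interval[of "int n" S] by simp
  hence "card {s\<in>{0..<int n}. \<not> S s} = nat (int l)"
    using assms(3,6) by (simp add: starts_def S_def)
  moreover have "int n < int r * int l" using assms(7) by (metis of_nat_less_iff of_nat_mult)
  moreover have "S 0" using assms(6,8) arc_eq_interval[of 0 l n]
    by (simp add: S_def atLeast0LessThan)
  moreover have "\<not> S (int n - 1)"
    using arc_last[OF assms(5,6)] assms(9) by (simp add: S_def)
  ultimately have "{s\<in>{0..<int n}. \<not> S s} = {int n - int l..<int n}"
    using missing_interval[of r "int n" "int l" S] uncovered_arcs[OF assms(1,2)] assms(4-6)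
    by (simp add: S_def)
  moreover have "int i \<notin> {int n - int l..<int n}" using assms(10) by simp
  moreover have "int i \<in> {0..<int n}" using assms(10) by simp
  ultimately have "S (int i)" by blast
  thus ?thesis using arc_eq_interval[of i l n] assms(10) by (simp add: S_def)
qed

lemma image_nth_middle:
  "(!) (xs @ ys @ zs) ` {length xs..<length xs + length ys} = set ys"
proof -
  have "{length xs..<length xs + length ys} = (\<lambda>i. i + length xs) ` {0..<length ys}"
    using image_add_atLeastLessThan'[of "length xs" 0 "length ys"] by (simp add: add.commute)
  hence "(!) (xs @ ys @ zs) ` {length xs..<length xs + length ys}
      = (\<lambda>i. (xs @ ys @ zs) ! (i + length xs)) ` {0..<length ys}"
    by (simp only: image_image)
  also have "\<dots> = (!) ys ` {0..<length ys}"
    by (intro image_cong) (auto simp: nth_append)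
  also have "\<dots> = set ys" by (simp add: nth_image)
  finally show ?thesis .
qed

section \<open>The extremal families\<close>

text \<open>
  List the ground set so that \<open>A\<close> and \<open>B\<close> are intervals and the cyclically last point is \<open>a'\<close>; the
  arc preceding \<open>A\<close> is then \<open>A - a + a'\<close>.
\<close>

lemma exchange_spreads:
  assumes "finite V" "card V = n" "\<G> \<subseteq> nsets V l" "cover_free r V \<G>"
    and "r > 1" "l < n" "n < r * l"
    and extremal: "\<And>f. f \<in> arrangements n V \<Longrightarrow> card (starts n l \<G> f) = n - l"
    and A: "A \<in> \<G>" "a \<in> A" and a': "a' \<in> V - A" "insert a' (A - {a}) \<notin> \<G>"
    and B: "B \<in> nsets V l" "a \<in> B" "a' \<notin> B"
  shows "B \<in> \<G>"
proof -
  have sub: "A \<subseteq> V" "finite A" "card A = l" "B \<subseteq> V" "finite B" "card B = l"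
    using A B assms(3) by (auto simp: nsets_def)
  have list: "\<exists>xs. distinct xs \<and> set xs = X" if "X \<subseteq> V" for X
    using that assms(1) finite_subset finite_distinct_list by metis
  obtain L1 where L1: "distinct L1" "set L1 = A - {a} - B"
    using list[of "A - {a} - B"] sub by blast
  obtain L2 where L2: "distinct L2" "set L2 = (A - {a}) \<inter> B"
    using list[of "(A - {a}) \<inter> B"] sub by blast
  obtain L3 where L3: "distinct L3" "set L3 = B - A"
    using list[of "B - A"] sub by blast
  obtain L4 where L4: "distinct L4" "set L4 = V - A - B - {a'}"
    using list[of "V - A - B - {a'}"] by blast
  \<comment> \<open>\<open>A\<close> fills the first block \<open>L1, L2, a\<close>, with
    \<open>a\<close> last, so stepping back by one position drops \<open>a\<close> and picks up
    \<open>a'\<close>. \<open>B\<close> fills the block \<open>L2, a, L3\<close> starting at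
    \<open>length L1\<close>, which ends before \<open>a'\<close>.\<close>
  define xs where "xs = L1 @ L2 @ [a] @ L3 @ L4 @ [a']"
  have xs: "distinct xs" "set xs = V"
    using L1 L2 L3 L4 A(2) a'(1) B(2,3) sub(1,4) by (auto simp: xs_def)
  have len: "length xs = n" using xs assms(2) distinct_card by metis
  have lenA: "length (L1 @ L2 @ [a]) = l"
  proof -
    have "length (L1 @ L2 @ [a]) = card (set (L1 @ L2 @ [a]))"
      by (rule distinct_card[symmetric]) (use L1 L2 in auto)
    also have "set (L1 @ L2 @ [a]) = A" using L1 L2 A by auto
    finally show ?thesis using sub by simp
  qed
  have lenB: "length (L2 @ [a] @ L3) = l"
  proof -
    have "length (L2 @ [a] @ L3) = card (set (L2 @ [a] @ L3))"
      by (rule distinct_card[symmetric]) (use L2 L3 A in auto)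
    also have "set (L2 @ [a] @ L3) = B" using L2 L3 B by auto
    finally show ?thesis using sub by simp
  qed
  define f where "f = restrict ((!) xs) {..<n}"
  have f: "f \<in> arrangements n V"
    using arrangement_of_list[OF xs(1)] by (simp add: f_def len xs(2))
  have f_nth: "f ` I = (!) xs ` I" if "I \<subseteq> {..<n}" for I
    using that unfolding f_def by (intro image_cong) auto
  have "f ` {..<l} = A"
    using image_nth_middle[of "[]" "L1 @ L2 @ [a]" "L3 @ L4 @ [a']"] lenA L1 L2 A assms(6)
    by (subst f_nth) (auto simp: xs_def atLeast0LessThan)
  moreover have "f ` insert (n - 1) {..<l-1} = insert a' (A - {a})"
  proof -
    have "length (L1 @ L2) = l - 1" using lenA by simp
    hence "(!) xs ` {..<l-1} = set (L1 @ L2)"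
      using image_nth_middle[of "[]" "L1 @ L2" "[a] @ L3 @ L4 @ [a']"]
      by (simp add: xs_def atLeast0LessThan)
    also have "\<dots> = A - {a}" using L1(2) L2(2) by auto
    finally have "(!) xs ` {..<l-1} = A - {a}" .
    moreover have "xs ! (n - 1) = a'"
      using len last_conv_nth[of xs] by (auto simp: xs_def)
    ultimately show ?thesis
      using assms(6) by (subst f_nth) auto
  qed
  moreover have "l > 0" using lenA by auto
  moreover have "length L1 + l < n" using len lenB by (auto simp: xs_def)
  ultimately have "f ` {length L1..<length L1 + l} \<in> \<G>"
    using starts_extremal_interval[OF assms(4) f extremal[OF f], of "length L1"] assms(5-7) A(1) a'(2)
    by simp
  also have "f ` {length L1..<length L1 + l} = (!) xs ` {length L1..<length L1 + l}"
    using \<open>length L1 + l < n\<close> by (intro f_nth) auto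
  also have "\<dots> = set (L2 @ [a] @ L3)"
    using image_nth_middle[of L1 "L2 @ [a] @ L3" "L4 @ [a']"] unfolding lenB
    by (simp only: xs_def append_assoc)
  also have "\<dots> = B" using L2 L3 B by auto
  finally show ?thesis .
qed

text \<open>Exchanging elements of \<open>A\<close> for elements of \<open>C\<close> one at a time
  leads from \<open>A\<close> to \<open>C\<close>, hence leaves \<open>\<G>\<close> at some
  step.\<close>

lemma exists_boundary_exchange:
  assumes "finite V" "\<G> \<subseteq> nsets V l" "A \<in> \<G>" "C \<in> nsets V l" "C \<notin> \<G>"
  shows "\<exists>A\<in>\<G>. \<exists>a\<in>A. \<exists>a'\<in>V - A. insert a' (A - {a}) \<notin> \<G>"
  using assms(3)
proof (induction "card (A - C)" arbitrary: A rule: less_induct)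
  case less
  have A: "A \<subseteq> V" "finite A" "card A = l" using less.prems assms(2) by (auto simp: nsets_def)
  have C: "C \<subseteq> V" "finite C" "card C = l" using assms(4) by (auto simp: nsets_def)
  have "A \<noteq> C" using less.prems assms(5) by auto
  then obtain a where a: "a \<in> A" "a \<notin> C"
    using A C card_subset_eq by (metis subsetI)
  obtain a' where a': "a' \<in> C" "a' \<notin> A"
    using \<open>A \<noteq> C\<close> A C card_subset_eq by (metis subsetI)
  show ?case
  proof (cases "insert a' (A - {a}) \<in> \<G>")
    case True
    have "insert a' (A - {a}) - C \<subset> A - C" using a a' by auto
    hence "card (insert a' (A - {a}) - C) < card (A - C)"
      using A by (intro psubset_card_mono) auto
    with less.hyps True show ?thesis by blast
  next
    case False
    with less.prems a a' C show ?thesis by blast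
  qed
qed

text \<open>The other \<open>n - 1\<close> points are listed from \<open>b\<close> to
  \<open>c\<close> and covered by \<open>r\<close> windows of length \<open>l - 1\<close>, each
  completed by \<open>a\<close>. A window shorter than the list cannot contain both of its
  ends.\<close>

lemma cover_through_point:
  assumes "finite V" "card V = n" "0 < l" "l < n" "n - 1 \<le> r * (l - 1)"
    and "a \<in> V" "b \<in> V" "c \<in> V" "a \<noteq> b" "a \<noteq> c" "b \<noteq> c"
  obtains H where "\<And>i. i < r \<Longrightarrow> H i \<in> nsets V l \<and> a \<in> H i \<and> \<not> (b \<in> H i \<and> c \<in> H i)"
    and "V \<subseteq> (\<Union>i<r. H i)"
proof -
  obtain W where W: "distinct W" "set W = V - {a, b, c}"
    using assms(1) finite_distinct_list by (metis finite_Diff)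
  define ys where "ys = b # W @ [c]"
  have ys: "distinct ys" "set ys = V - {a}" using W assms by (auto simp: ys_def)
  have len: "length ys = n - 1"
    using distinct_card[OF ys(1)] ys(2) assms by (simp add: card_Diff_singleton)
  define m N where "m = l - 1" and "N = n - 1"
  have mN: "m < N" "N \<le> r * m" using assms by (auto simp: m_def N_def)
  have "m > 0" using mN by (cases m) auto
  \<comment> \<open>The minimum pushes windows that would run over the end of the list back to its
    last \<open>m\<close> entries.\<close>
  define s where "s = (\<lambda>i. min (i * m) (N - m))"
  define H where "H = (\<lambda>i. insert a ((!) ys ` {s i..<s i + m}))"
  have range: "{s i..<s i + m} \<subseteq> {..<N}" for i using mN by (auto simp: s_def)
  have inj: "inj_on ((!) ys) {..<N}"
    using inj_on_nth[OF ys(1)] len by (simp add: N_def)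
  have ys_in: "(!) ys ` {..<N} = V - {a}"
    using nth_image[of N ys] ys len by (simp add: N_def atLeast0LessThan)
  have "H i \<in> nsets V l \<and> a \<in> H i \<and> \<not> (b \<in> H i \<and> c \<in> H i)" for i
  proof (intro conjI)
    have sub: "(!) ys ` {s i..<s i + m} \<subseteq> V - {a}" using range[of i] ys_in by blast
    have "card ((!) ys ` {s i..<s i + m}) = m"
      using inj_on_subset[OF inj range[of i]] by (simp add: card_image)
    moreover have "a \<notin> (!) ys ` {s i..<s i + m}" using sub by blast
    ultimately show "H i \<in> nsets V l"
      using sub assms(3,6) by (auto simp: nsets_def H_def m_def)
    show "a \<in> H i" by (simp add: H_def)
    show "\<not> (b \<in> H i \<and> c \<in> H i)"
    proof
      assume "b \<in> H i \<and> c \<in> H i"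
      moreover have "b = ys ! 0" by (simp add: ys_def)
      moreover have "c = ys ! (N - 1)"
      proof -
        have "N - 1 = length (b # W)" using len by (simp add: ys_def N_def)
        thus ?thesis using nth_append_length[of "b # W" c "[]"] by (simp only: ys_def append_Cons)
      qed
      ultimately have *: "ys ! 0 \<in> (!) ys ` {s i..<s i + m}" "ys ! (N - 1) \<in> (!) ys ` {s i..<s i + m}"
        using assms(9,10) by (auto simp: H_def)
      have "j \<in> {s i..<s i + m}" if "j < N" "ys ! j \<in> (!) ys ` {s i..<s i + m}" for j
        using that inj range[of i] by (meson inj_on_image_mem_iff lessThan_iff)
      from this[OF _ *(1)] this[OF _ *(2)] show False using mN by auto
    qed
  qed
  moreover have "V \<subseteq> (\<Union>i<r. H i)"
  proof
    fix v assume v: "v \<in> V"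
    show "v \<in> (\<Union>i<r. H i)"
    proof (cases "v = a")
      case True
      have "r > 0" using mN by (cases r) auto
      thus ?thesis using True by (auto simp: H_def)
    next
      case False
      then obtain j where j: "j < N" "v = ys ! j" using v ys_in by blast
      define i where "i = j div m"
      have "i < r" using j(1) mN(2) \<open>m > 0\<close> by (simp add: i_def less_mult_imp_div_less)
      have *: "i * m + j mod m = j" "j mod m < m" using \<open>m > 0\<close> by (simp_all add: i_def)
      have "s i \<le> j" unfolding s_def using * by linarith
      moreover have "j < s i + m" unfolding s_def using * j(1) mN by linarith
      ultimately have "v \<in> H i" using j(2) by (auto simp: H_def)
      with \<open>i < r\<close> show ?thesis by blast
    qed
  qed
  ultimately show ?thesis by (intro that[of H])
qed

lemma extremal_cover_free:
  assumes "finite V" "card V = n" "\<G> \<subseteq> nsets V l" "cover_free r V \<G>"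
    and "r > 1" "0 < l" "l < n" "n - 1 \<le> r * (l - 1)"
    and large: "(n - 1) choose l \<le> card \<G>"
  shows "\<exists>x\<in>V. \<forall>B\<in>\<G>. x \<notin> B"
proof -
  have r: "n < r * l"
    using assms(5-8) by (cases l) auto
  have fin: "finite \<G>" using assms(1,3) finite_subset finite_imp_finite_nsets by metis
  have extremal: "card (starts n l \<G> f) = n - l" if "f \<in> arrangements n V" for f
    using card_starts_extremal[OF assms(1-4) _ assms(6,7) _ large that] r assms(5) by simp
  have st: "starts n l \<G> f \<noteq> {}" if "f \<in> arrangements n V" for f
    using extremal[OF that] assms(7) by auto
  obtain f where f: "f \<in> arrangements n V"
    using arrangements_nonempty[OF assms(1,2)] by blast
  \<comment> \<open>Some arcs of \<open>f\<close> are inside \<open>\<G>\<close> and some outside,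
    so a boundary exchange exists.\<close>
  have "starts n l \<G> f \<noteq> {0..<int n}"
  proof
    assume "starts n l \<G> f = {0..<int n}"
    with extremal[OF f] assms(6,7) show False by simp
  qed
  then obtain s where s: "f ` arc n l s \<notin> \<G>" unfolding starts_def by blast
  have "f ` arc n l s \<in> nsets V l"
  proof -
    have f': "inj_on f {..<n}" "f ` {..<n} = V"
      using f by (simp_all add: arrangements_def bij_betw_def)
    have sub: "f ` arc n l s \<subseteq> V" using f'(2) arc_subset by blast
    have "card (f ` arc n l s) = l"
      using inj_on_subset[OF f'(1) arc_subset] assms(7) by (simp add: card_image card_arc)
    with sub show ?thesis using finite_subset[OF sub assms(1)] by (simp add: nsets_def)
  qed
  moreover obtain A where "A \<in> \<G>" using st[OF f] by (auto simp: starts_def)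
  ultimately obtain A a a' where A: "A \<in> \<G>" "a \<in> A" "a' \<in> V - A" "insert a' (A - {a}) \<notin> \<G>"
    using exists_boundary_exchange[OF assms(1,3)] s by blast
  have spread: "D \<in> \<G>"
    if "C \<in> \<G>" "c \<in> C" "c' \<in> V - C" "insert c' (C - {c}) \<notin> \<G>"
      "D \<in> nsets V l" "c \<in> D" "c' \<notin> D" for C D c c'
    using exchange_spreads[OF assms(1-5,7) r _ that] extremal by blast
  have aV: "a \<in> V" using A assms(3) by (auto simp: nsets_def)
  have "nsets (V - {a'}) l \<subseteq> \<G>"
  proof
    fix B assume "B \<in> nsets (V - {a'}) l"
    hence B: "B \<in> nsets V l" "a' \<notin> B" by (auto simp: nsets_def)
    show "B \<in> \<G>"
    proof (rule ccontr)
      assume "B \<notin> \<G>"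
      with spread[OF A B(1) _ B(2)] have "a \<notin> B" by blast
      have "card B = l" "finite B" "B \<subseteq> V" using B by (auto simp: nsets_def)
      with assms(6) obtain b where b: "b \<in> B" by (metis card.empty ex_in_conv less_irrefl)
      \<comment> \<open>\<open>B'\<close> has \<open>a\<close> but not \<open>a'\<close>, so it lies
        in \<open>\<G>\<close>, while exchanging \<open>a\<close> for \<open>b\<close> leads back to
        \<open>B\<close>. This second boundary exchange puts every \<open>l\<close>-set with
        \<open>a\<close> but without \<open>b\<close> into \<open>\<G>\<close>.\<close>
      define B' where "B' = insert a (B - {b})"
      have "B' \<in> nsets V l"
        using \<open>a \<notin> B\<close> b \<open>card B = l\<close> \<open>finite B\<close> \<open>B \<subseteq> V\<close> aV assms(6)
        by (auto simp: nsets_def B'_def card_Diff_singleton)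
      moreover have "a' \<notin> B'" using A B by (auto simp: B'_def)
      ultimately have B': "B' \<in> \<G>" using spread[OF A] by (simp add: B'_def)
      have "insert b (B' - {a}) = B" using b \<open>a \<notin> B\<close> by (auto simp: B'_def)
      hence bV: "b \<in> V - B'" "insert b (B' - {a}) \<notin> \<G>"
        using b \<open>a \<notin> B\<close> \<open>B \<subseteq> V\<close> \<open>B \<notin> \<G>\<close> by (auto simp: B'_def)
      \<comment> \<open>Every \<open>l\<close>-set through \<open>a\<close> that omits
        \<open>b\<close> or \<open>a'\<close> is now in \<open>\<G>\<close>; \<open>r\<close> of
        these cover \<open>V\<close>.\<close>
      have "a \<noteq> b" "a \<noteq> a'" "b \<noteq> a'" using A B b \<open>a \<notin> B\<close> by auto
      then obtain H where H: "\<And>i. i < r \<Longrightarrow> H i \<in> nsets V l \<and> a \<in> H i \<and> \<not> (b \<in> H i \<and> a' \<in> H i)"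
        "V \<subseteq> (\<Union>i<r. H i)"
        using cover_through_point[OF assms(1,2,6-8) aV, of b a'] bV A by auto
      have "H i \<in> \<G>" if "i < r" for i
      proof (cases "a' \<in> H i")
        case True
        then show ?thesis
          using H(1)[OF that] spread[OF B' _ bV, of "H i"] by (simp add: B'_def)
      next
        case False
        then show ?thesis using H(1)[OF that] spread[OF A, of "H i"] by simp
      qed
      hence "\<not> V \<subseteq> (\<Union>i<r. H i)"
        using assms(4)[unfolded cover_free_def, THEN spec[of _ H]] by simp
      with H(2) show False by contradiction
    qed
  qed
  \<comment> \<open>With exactly \<open>n - l\<close> arcs in every arrangement, the double count
    determines \<open>card \<G>\<close>.\<close>
  moreover have "card \<G> \<le> card (nsets (V - {a'}) l)"
  proof -
    let ?P = "arrangements n V"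
    have "n * card \<G> * card ?P = (\<Sum>f\<in>?P. card (starts n l \<G> f)) * (n choose l)"
      using sum_card_starts[of V n \<G> l] assms by simp
    also have "\<dots> = card ?P * ((n - l) * (n choose l))" by (simp add: extremal)
    also have "\<dots> = card ?P * (n * ((n - 1) choose l))" by (simp add: binomial_absorb_comp)
    finally have "n * card ?P * card \<G> = n * card ?P * ((n - 1) choose l)"
      by (simp only: mult_ac)
    moreover have "n * card ?P \<noteq> 0"
      using assms(7) f finite_arrangements[OF assms(1), of n] by auto
    ultimately have "card \<G> = (n - 1) choose l" by simp
    thus ?thesis using A assms(1,2) by (simp add: card_nsets_choose card_Diff_singleton)
  qed
  ultimately have "\<G> = nsets (V - {a'}) l"
    using card_seteq[OF fin, of "nsets (V - {a'}) l"] by simp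
  thus ?thesis using A by (auto simp: nsets_def)
qed

text \<open>A family at least this large would have extremal complements of size
  \<open>l = n - k\<close>, and a point avoided by all complements is common to all members.\<close>

lemma nontrivial_card_less:
  assumes "finite V" "card V = n" "\<F> \<subseteq> nsets V k" "wise_intersecting r \<F>" "nontrivial_family \<F>"
    and "r > 1" "0 < k" "k < n" "n - 1 \<le> r * (n - k - 1)"
  shows "card \<F> < (n - 1) choose (k - 1)"
proof (rule ccontr)
  assume "\<not> ?thesis"
  hence large: "(n - 1) choose (k - 1) \<le> card \<F>" by simp
  define \<G> where "\<G> = (\<lambda>F. V - F) ` \<F>"
  have sub: "F \<subseteq> V" if "F \<in> \<F>" for F using that assms(3) by (auto simp: nsets_def)
  have "inj_on (\<lambda>F. V - F) \<F>"
    using sub by (intro inj_onI) (metis double_diff order_refl)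
  hence "card \<G> = card \<F>" by (simp add: \<G>_def card_image)
  moreover have "(n - 1) choose (k - 1) = (n - 1) choose (n - k)"
    using assms(7,8) binomial_symmetric[of "k - 1" "n - 1"] by simp
  ultimately have "(n - 1) choose (n - k) \<le> card \<G>" using large by simp
  moreover have "\<G> \<subseteq> nsets V (n - k)"
    using assms(1-3) by (auto simp: \<G>_def nsets_def card_Diff_subset)
  moreover have "cover_free r V \<G>"
    unfolding cover_free_def
  proof (intro allI impI)
    fix H :: "nat \<Rightarrow> 'a set" assume H: "\<forall>i<r. H i \<in> \<G>"
    have "\<forall>i\<in>{1..r}. V - H (i - 1) \<in> \<F>"
    proof
      fix i assume "i \<in> {1..r}"
      hence "H (i - 1) \<in> \<G>" using H by auto
      then obtain F where "F \<in> \<F>" "H (i - 1) = V - F" by (auto simp: \<G>_def)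
      thus "V - H (i - 1) \<in> \<F>" using sub[of F] by (simp add: double_diff)
    qed
    hence "(\<Inter>i\<in>{1..r}. V - H (i - 1)) \<noteq> {}"
      by (rule assms(4)[unfolded wise_intersecting_def, THEN spec[of _ "\<lambda>i. V - H (i - 1)"], THEN mp])
    then obtain v where v: "\<And>i. i \<in> {1..r} \<Longrightarrow> v \<in> V - H (i - 1)" by blast
    have "v \<in> V" using v[of 1] assms(6) by simp
    moreover have "v \<notin> H i" if "i < r" for i using v[of "Suc i"] that by simp
    ultimately show "\<not> V \<subseteq> (\<Union>i<r. H i)" by blast
  qed
  ultimately obtain x where x: "x \<in> V" "\<forall>B\<in>\<G>. x \<notin> B"
    using extremal_cover_free[OF assms(1,2), of \<G> "n - k" r] assms(6-9) by auto
  hence "x \<in> \<Inter>\<F>" by (auto simp: \<G>_def)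
  with assms(5) show False by (simp add: nontrivial_family_def)
qed

section \<open>A large non-trivial family\<close>

lemma card_Diff_eq_sum:
  assumes "finite T"
  shows "real (card (T - E)) = (\<Sum>x\<in>T. of_bool (x \<notin> E))"
proof -
  have "T - E = {x\<in>T. x \<notin> E}" by auto
  thus ?thesis using assms by (simp add: Int_def)
qed

lemma card_nsets_avoiding:
  assumes "finite U" "X \<subseteq> U"
  shows "card {E \<in> nsets U K. X \<inter> E = {}} = (card U - card X) choose K"
proof -
  have "{E \<in> nsets U K. X \<inter> E = {}} = nsets (U - X) K" by (auto simp: nsets_def)
  thus ?thesis using assms finite_subset[OF assms(2,1)]
    by (simp add: card_nsets_choose card_Diff_subset)
qed

lemma choose_pred_real:
  assumes "0 < N" "K \<le> N"
  shows "real ((N - 1) choose K) = (real N - real K) / real N * real (N choose K)"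
proof -
  have "real (N - K) * real (N choose K) = real N * real ((N - 1) choose K)"
    using binomial_absorb_comp[of N K] by (metis of_nat_mult)
  thus ?thesis using assms by (simp add: field_simps of_nat_diff)
qed

text \<open>A random \<open>K\<close>-set avoids one given point with probability
  \<open>(N - K) / N\<close>; avoiding two given points is negatively correlated.\<close>

lemma choose_pred2_le:
  assumes "2 \<le> N" "K \<le> N"
  shows "real ((N - 2) choose K) \<le> ((real N - real K) / real N)\<^sup>2 * real (N choose K)"
proof (cases "K = N")
  case True
  then show ?thesis using assms by (simp add: binomial_eq_0)
next
  case False
  define q where "q = (real N - real K) / real N"
  have N1: "real (N - 1) = real N - 1" using assms by linarith
  have "real ((N - 2) choose K) = (real (N - 1) - real K) / real (N - 1) * real ((N - 1) choose K)"
    using choose_pred_real[of "N - 1" K] assms False by (simp add: diff_diff_eq numeral_2_eq_2)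
  also have "\<dots> \<le> q * real ((N - 1) choose K)"
  proof (rule mult_right_mono)
    \<comment> \<open>The right side exceeds the left by \<open>K\<close>.\<close>
    have "(real N - 1 - real K) * real N \<le> (real N - real K) * (real N - 1)"
      by (simp add: algebra_simps)
    thus "(real (N - 1) - real K) / real (N - 1) \<le> q"
      using assms unfolding q_def N1 by (simp add: divide_le_eq pos_le_divide_eq mult.commute)
  qed simp
  also have "\<dots> = q\<^sup>2 * real (N choose K)"
    using choose_pred_real[of N K] assms by (simp add: q_def power2_eq_square)
  finally show ?thesis by (simp add: q_def)
qed

text \<open>An unnormalised variance bound: the indicators of \<open>x \<notin> E\<close> have mean
  \<open>q\<close> and nonpositive covariances, so the variance of their sum is at most
  \<open>card T * q * (1 - q)\<close>.\<close>

lemma sum_square_deviation_le: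
  fixes U T :: "'a set" and q :: real
  assumes "finite U" "card U = N" "T \<subseteq> U" "2 \<le> N" "K \<le> N"
  defines "q \<equiv> (real N - real K) / real N"
  shows "(\<Sum>E\<in>nsets U K. (real (card (T - E)) - real (card T) * q)\<^sup>2)
           \<le> real (card T) * real (N choose K)"
proof -
  let ?S = "nsets U K"
  define t C X where "t = real (card T)" and "C = real (N choose K)"
    and "X = (\<lambda>E. real (card (T - E)))"
  have fin: "finite ?S" "finite T"
    using assms finite_subset by (auto simp: finite_imp_finite_nsets)
  have X: "X E = (\<Sum>x\<in>T. of_bool (x \<notin> E))" for E
    using card_Diff_eq_sum[OF fin(2)] by (simp add: X_def)
  have q: "0 \<le> q" "q \<le> 1" using assms(4,5) by (auto simp: q_def)
  have card1: "(\<Sum>E\<in>?S. of_bool (x \<notin> E)) = q * C" if "x \<in> T" for x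
  proof -
    have "(\<Sum>E\<in>?S. of_bool (x \<notin> E)) = real (card {E \<in> ?S. {x} \<inter> E = {}})"
      using fin by (simp add: Int_def cong: conj_cong)
    also have "\<dots> = real ((N - 1) choose K)"
      using card_nsets_avoiding[OF assms(1), of "{x}" K] that assms(2,3) by auto
    also have "\<dots> = q * C" using choose_pred_real[of N K] assms(4,5) by (simp add: q_def C_def)
    finally show ?thesis .
  qed
  have card2: "(\<Sum>E\<in>?S. of_bool (x \<notin> E \<and> y \<notin> E)) \<le> q\<^sup>2 * C" if "x \<in> T" "y \<in> T" "x \<noteq> y" for x y
  proof -
    have "{E \<in> ?S. {x, y} \<inter> E = {}} = ?S \<inter> {E. x \<notin> E \<and> y \<notin> E}" by auto
    hence "(\<Sum>E\<in>?S. of_bool (x \<notin> E \<and> y \<notin> E)) = real (card {E \<in> ?S. {x, y} \<inter> E = {}})"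
      using fin by simp
    also have "\<dots> = real ((N - 2) choose K)"
      using card_nsets_avoiding[OF assms(1), of "{x, y}" K] that assms(2,3) by (auto simp: numeral_2_eq_2)
    also have "\<dots> \<le> q\<^sup>2 * C" using choose_pred2_le[of N K] assms(4,5) by (simp add: q_def C_def)
    finally show ?thesis .
  qed
  have first: "(\<Sum>E\<in>?S. X E) = t * q * C"
  proof -
    have "(\<Sum>E\<in>?S. X E) = (\<Sum>x\<in>T. \<Sum>E\<in>?S. of_bool (x \<notin> E))"
      unfolding X by (rule sum.swap)
    also have "\<dots> = t * q * C" by (simp add: card1 t_def)
    finally show ?thesis .
  qed
  have second: "(\<Sum>E\<in>?S. (X E)\<^sup>2) \<le> t * (q * C + (t - 1) * (q\<^sup>2 * C))"
  proof -
    have "(X E)\<^sup>2 = (\<Sum>x\<in>T. \<Sum>y\<in>T. of_bool (x \<notin> E \<and> y \<notin> E))" for E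
      unfolding X power2_eq_square sum_product of_bool_conj ..
    hence "(\<Sum>E\<in>?S. (X E)\<^sup>2) = (\<Sum>E\<in>?S. \<Sum>x\<in>T. \<Sum>y\<in>T. of_bool (x \<notin> E \<and> y \<notin> E))"
      by simp
    also have "\<dots> = (\<Sum>x\<in>T. \<Sum>E\<in>?S. \<Sum>y\<in>T. of_bool (x \<notin> E \<and> y \<notin> E))"
      by (rule sum.swap)
    also have "\<dots> = (\<Sum>x\<in>T. \<Sum>y\<in>T. \<Sum>E\<in>?S. of_bool (x \<notin> E \<and> y \<notin> E))"
      by (intro sum.cong refl sum.swap)
    also have "\<dots> \<le> (\<Sum>x\<in>T. q * C + (t - 1) * (q\<^sup>2 * C))"
    proof (rule sum_mono)
      fix x assume x: "x \<in> T"
      hence "card T > 0" using fin(2) card_gt_0_iff by blast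
      hence "real (card (T - {x})) = t - 1"
        using x fin(2) by (simp add: t_def card_Diff_singleton of_nat_diff)
      have "(\<Sum>y\<in>T. \<Sum>E\<in>?S. of_bool (x \<notin> E \<and> y \<notin> E))
          = (\<Sum>E\<in>?S. of_bool (x \<notin> E)) + (\<Sum>y\<in>T - {x}. \<Sum>E\<in>?S. of_bool (x \<notin> E \<and> y \<notin> E))"
        by (subst sum.remove[OF fin(2) x]) simp
      also have "\<dots> \<le> q * C + (\<Sum>y\<in>T - {x}. q\<^sup>2 * C)"
        unfolding card1[OF x] using card2[OF x] by (intro add_left_mono sum_mono) auto
      also have "\<dots> = q * C + (t - 1) * (q\<^sup>2 * C)"
        using \<open>real (card (T - {x})) = t - 1\<close> by (simp only: sum_constant)
      finally show "(\<Sum>y\<in>T. \<Sum>E\<in>?S. of_bool (x \<notin> E \<and> y \<notin> E)) \<le> q * C + (t - 1) * (q\<^sup>2 * C)" .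
    qed
    also have "\<dots> = t * (q * C + (t - 1) * (q\<^sup>2 * C))" by (simp add: t_def)
    finally show ?thesis .
  qed
  have "card ?S = N choose K" using assms(1,2) by (simp add: card_nsets_choose)
  hence "(\<Sum>E\<in>?S. (X E - t * q)\<^sup>2) = (\<Sum>E\<in>?S. (X E)\<^sup>2) - 2 * (t * q) * (\<Sum>E\<in>?S. X E) + (t * q)\<^sup>2 * C"
    by (simp add: power2_diff sum.distrib sum_subtractf sum_distrib_left C_def mult_ac)
  also have "\<dots> \<le> t * (q * C + (t - 1) * (q\<^sup>2 * C)) - 2 * (t * q) * (t * q * C) + (t * q)\<^sup>2 * C"
    using second unfolding first by simp
  \<comment> \<open>The terms quadratic in \<open>t\<close> cancel, because the bound for pairs is
    the square of the value for points.\<close>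
  also have "\<dots> = t * C * (q - q\<^sup>2)"
    by (simp add: power2_eq_square algebra_simps)
  also have "\<dots> \<le> t * C * 1"
  proof (rule mult_left_mono)
    show "q - q\<^sup>2 \<le> 1" using q zero_le_power2[of q] by linarith
  qed (simp add: t_def C_def)
  finally show ?thesis by (simp add: X_def t_def C_def)
qed

text \<open>Chebyshev's inequality: every counted set deviates from the mean
  \<open>card T * q\<close> by at least \<open>card T * \<eta>\<close>.\<close>

lemma card_many_missing_le:
  fixes U T :: "'a set" and q \<eta> c :: real
  assumes "finite U" "card U = N" "T \<subseteq> U" "2 \<le> N" "K \<le> N" "T \<noteq> {}"
    and "0 < \<eta>" "(real N - real K) / real N + \<eta> \<le> c"
  shows "real (card {E \<in> nsets U K. real (card T) * c \<le> real (card (T - E))})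
           \<le> real (N choose K) / (real (card T) * \<eta>\<^sup>2)"
proof -
  define q where "q = (real N - real K) / real N"
  define bad where "bad = {E \<in> nsets U K. real (card T) * c \<le> real (card (T - E))}"
  have t: "0 < real (card T)"
    using assms(1,3,6) finite_subset by (metis card_gt_0_iff of_nat_0_less_iff)
  have "real (card bad) * (real (card T) * \<eta>)\<^sup>2 = (\<Sum>E\<in>bad. (real (card T) * \<eta>)\<^sup>2)" by simp
  also have "\<dots> \<le> (\<Sum>E\<in>bad. (real (card (T - E)) - real (card T) * q)\<^sup>2)"
  proof (rule sum_mono)
    fix E assume "E \<in> bad"
    hence "real (card T) * c \<le> real (card (T - E))" by (simp add: bad_def)
    moreover have "real (card T) * (q + \<eta>) \<le> real (card T) * c"
      using assms(8) t by (intro mult_left_mono) (auto simp: q_def)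
    ultimately have "real (card T) * \<eta> \<le> real (card (T - E)) - real (card T) * q"
      by (simp add: algebra_simps)
    thus "(real (card T) * \<eta>)\<^sup>2 \<le> (real (card (T - E)) - real (card T) * q)\<^sup>2"
      using assms(7) by (intro power_mono) auto
  qed
  also have "\<dots> \<le> (\<Sum>E\<in>nsets U K. (real (card (T - E)) - real (card T) * q)\<^sup>2)"
    using assms(1) by (intro sum_mono2) (auto simp: bad_def finite_imp_finite_nsets)
  also have "\<dots> \<le> real (card T) * real (N choose K)"
    unfolding q_def by (rule sum_square_deviation_le[OF assms(1-5)])
  finally have "(real (card bad) * (real (card T) * \<eta>\<^sup>2)) * real (card T) \<le> real (N choose K) * real (card T)"
    by (simp add: power2_eq_square mult_ac)
  hence "real (card bad) * (real (card T) * \<eta>\<^sup>2) \<le> real (N choose K)"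
    by (rule mult_right_le_imp_le) (rule t)
  thus ?thesis using t assms(7) by (simp add: bad_def pos_le_divide_eq)
qed

section \<open>The threshold family and its size\<close>

text \<open>The product form expresses, without division, that \<open>F\<close> misses less than a
  fraction \<open>1/(r-1)\<close> of \<open>T\<close>.\<close>

definition threshold_family :: "nat \<Rightarrow> 'a \<Rightarrow> 'a set \<Rightarrow> 'a set \<Rightarrow> nat \<Rightarrow> 'a set set" where
  "threshold_family r v T V k =
     {F \<in> nsets V k. v \<in> F \<and> (r - 1) * card (T - F) < card T} \<union> {F \<in> nsets V k. v \<notin> F \<and> T \<subseteq> F}"

text \<open>Unless all sets share \<open>v\<close>, one of them contains \<open>T\<close>. The other
  \<open>r - 1\<close> each miss fewer than \<open>card T / (r - 1)\<close> points of
  \<open>T\<close>, so together they cannot miss all of \<open>T\<close>.\<close>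

lemma threshold_family_wise_intersecting:
  assumes "finite T" "T \<noteq> {}" "1 < r"
  shows "wise_intersecting r (threshold_family r v T V k)"
  unfolding wise_intersecting_def
proof (intro allI impI)
  fix F assume F: "\<forall>i\<in>{1..r}. F i \<in> threshold_family r v T V k"
  show "(\<Inter>i\<in>{1..r}. F i) \<noteq> {}"
  proof (cases "\<forall>i\<in>{1..r}. v \<in> F i")
    case True
    then show ?thesis by blast
  next
    case False
    then obtain j where j: "j \<in> {1..r}" "T \<subseteq> F j"
      using F by (auto simp: threshold_family_def)
    let ?I = "{1..r} - {j}"
    have cardI: "card ?I = r - 1" using j(1) by (simp add: card_Diff_singleton)
    hence "?I \<noteq> {}" using assms(3) by (metis card.empty not_less_iff_gr_or_eq zero_less_diff)
    show ?thesis
    proof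
      assume empty: "(\<Inter>i\<in>{1..r}. F i) = {}"
      have "T \<subseteq> (\<Union>i\<in>?I. T - F i)" using empty j by blast
      hence "card T \<le> card (\<Union>i\<in>?I. T - F i)"
        using assms(1) by (intro card_mono) auto
      also have "\<dots> \<le> (\<Sum>i\<in>?I. card (T - F i))" by (intro card_UN_le) simp
      finally have "(r - 1) * card T \<le> (\<Sum>i\<in>?I. (r - 1) * card (T - F i))"
        by (simp flip: sum_distrib_left)
      also have "\<dots> < (\<Sum>i\<in>?I. card T)"
      proof (rule sum_strict_mono)
        fix i assume "i \<in> ?I"
        hence "F i \<in> threshold_family r v T V k" using F by auto
        moreover have "0 < card T" using assms(1,2) by (simp add: card_gt_0_iff)
        moreover have "card (T - F i) = 0" if "T \<subseteq> F i"
          using that by (metis Diff_eq_empty_iff card.empty)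
        ultimately show "(r - 1) * card (T - F i) < card T"
          by (auto simp: threshold_family_def)
      qed (use \<open>?I \<noteq> {}\<close> in auto)
      also have "\<dots> = (r - 1) * card T" by (simp only: sum_constant cardI of_nat_id)
      finally show False by simp
    qed
  qed
qed

text \<open>A member of the second kind avoids \<open>v\<close>. Any other \<open>x\<close> is
  avoided by a member containing \<open>v\<close> and \<open>T - {x}\<close>; it misses at most one
  point of \<open>T\<close>, which is permitted since \<open>r - 1 < card T\<close>.\<close>

lemma threshold_family_nontrivial:
  assumes "finite V" "v \<in> V" "T \<subseteq> V - {v}" "r \<le> card T" "1 < r" "card T < k" "k < card V"
  shows "nontrivial_family (threshold_family r v T V k)"
  unfolding nontrivial_family_def
proof (rule equals0I)
  fix x assume x: "x \<in> \<Inter>(threshold_family r v T V k)"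
  have fin: "finite T" using assms(1,3) finite_subset by blast
  show False
  proof (cases "x = v")
    case True
    have "card (V - {v}) = card V - 1" using assms by (simp add: card_Diff_singleton)
    hence "k \<le> card (V - {v})" using assms(7) by linarith
    then obtain F where F: "T \<subseteq> F" "F \<subseteq> V - {v}" "card F = k"
      using exists_subset_between[OF less_imp_le[OF assms(6)] _ assms(3)] assms(1) by blast
    have "F \<in> threshold_family r v T V k"
      using F assms(1) finite_subset[of F V] by (auto simp: threshold_family_def nsets_def)
    with x True F show False by blast
  next
    case False
    have "card V - 1 \<le> card (V - {x})"
      using diff_card_le_card_Diff[of "{x}" V] by simp
    hence "k \<le> card (V - {x})" using assms(7) by linarith
    moreover have "card (insert v (T - {x})) \<le> k"
      using card_insert_le_m1 fin assms(6) card_Diff1_le[of T x] by (simp add: card_insert_if)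
    moreover have "insert v (T - {x}) \<subseteq> V - {x}" using assms False by auto
    ultimately obtain F where F: "insert v (T - {x}) \<subseteq> F" "F \<subseteq> V - {x}" "card F = k"
      using exists_subset_between[of "insert v (T - {x})" k "V - {x}"] assms(1) by blast
    have "card (T - F) \<le> card {x}" using F by (intro card_mono) auto
    hence "(r - 1) * card (T - F) \<le> (r - 1) * 1" by (intro mult_le_mono2) simp
    also have "\<dots> < card T" using assms by simp
    finally have "F \<in> threshold_family r v T V k"
      using F assms(1) finite_subset[of F V] by (auto simp: threshold_family_def nsets_def)
    with x F show False by blast
  qed
qed

text \<open>Only members through \<open>v\<close> are counted. Removing \<open>v\<close> leaves
  \<open>(k - 1)\<close>-subsets of an \<open>(n - 1)\<close>-set, to which Chebyshev's inequality
  applies with threshold \<open>1/(r-1)\<close>.\<close>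

lemma card_threshold_family_ge:
  fixes \<eta> :: real
  assumes "finite V" "card V = n" "v \<in> V" "T \<subseteq> V - {v}" "T \<noteq> {}" "1 < r" "3 \<le> n" "0 < k" "k \<le> n"
    and "0 < \<eta>" "(real n - real k) / (real n - 1) + \<eta> \<le> 1 / (real r - 1)"
  shows "(1 - 1 / (real (card T) * \<eta>\<^sup>2)) * real ((n - 1) choose (k - 1))
           \<le> real (card (threshold_family r v T V k))"
proof -
  let ?U = "V - {v}" and ?C = "(n - 1) choose (k - 1)"
  have U: "finite ?U" "card ?U = n - 1" using assms by (auto simp: card_Diff_singleton)
  define bad where "bad = {E \<in> nsets ?U (k - 1). real (card T) * (1 / (real r - 1)) \<le> real (card (T - E))}"
  define good where "good = {E \<in> nsets ?U (k - 1). (r - 1) * card (T - E) < card T}"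
  have "real (card bad) \<le> real ?C / (real (card T) * \<eta>\<^sup>2)"
    unfolding bad_def using assms U
    by (intro card_many_missing_le) (auto simp: of_nat_diff)
  moreover have "good = nsets ?U (k - 1) - bad"
  proof -
    have "real (card T) * (1 / (real r - 1)) \<le> real (card (T - E)) \<longleftrightarrow> card T \<le> (r - 1) * card (T - E)" for E
    proof -
      have "real (card T) * (1 / (real r - 1)) \<le> real (card (T - E))
          \<longleftrightarrow> real (card T) \<le> real ((r - 1) * card (T - E))"
        using assms(6) by (simp add: of_nat_diff pos_divide_le_eq mult.commute)
      thus ?thesis by (simp only: of_nat_le_iff)
    qed
    thus ?thesis unfolding good_def bad_def by auto
  qed
  moreover have "bad \<subseteq> nsets ?U (k - 1)" by (auto simp: bad_def)
  moreover have "finite (nsets ?U (k - 1))" using U by (simp add: finite_imp_finite_nsets)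
  ultimately have good: "real ?C - real ?C / (real (card T) * \<eta>\<^sup>2) \<le> real (card good)"
    using U card_mono[of "nsets ?U (k - 1)" bad]
    by (simp add: card_Diff_subset finite_subset of_nat_diff card_nsets_choose)
  have "card good \<le> card (threshold_family r v T V k)"
  proof (rule card_inj_on_le)
    show "inj_on (insert v) good"
      by (rule inj_onI) (auto simp: good_def nsets_def dest: insert_ident)
    show "insert v ` good \<subseteq> threshold_family r v T V k"
    proof
      fix F assume "F \<in> insert v ` good"
      then obtain E where E: "E \<in> good" "F = insert v E" by blast
      hence "T - F = T - E" using assms(4) by auto
      with E assms(3,8) show "F \<in> threshold_family r v T V k"
        by (auto simp: good_def threshold_family_def nsets_def card_insert_if)
    qed
    show "finite (threshold_family r v T V k)"
      using finite_imp_finite_nsets[OF assms(1)] by (simp add: threshold_family_def)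
  qed
  with good show ?thesis by (simp add: left_diff_distrib)
qed

section \<open>Combining the two bounds\<close>

text \<open>The family at hand shows that the maximum is over a nonempty set, so it is attained and
  the strict bound passes to it.\<close>

lemma max_nontrivial_bounds:
  assumes less: "\<And>\<F>. \<F> \<subseteq> nsets {1..n} k \<Longrightarrow> wise_intersecting r \<F> \<Longrightarrow> nontrivial_family \<F> \<Longrightarrow> card \<F> < b"
    and \<F>: "\<F> \<subseteq> nsets {1..n} k" "wise_intersecting r \<F>" "nontrivial_family \<F>"
  shows "card \<F> \<le> max_nontrivial r n k" "max_nontrivial r n k < b"
proof -
  let ?M = "{card \<F> | \<F>. \<F> \<subseteq> nsets {1..n} k \<and> wise_intersecting r \<F> \<and> nontrivial_family \<F>}"
  have "?M \<subseteq> card ` Pow (nsets {1..n} k)" by auto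
  hence fin: "finite ?M" by (rule finite_subset) (simp add: finite_imp_finite_nsets)
  have mem: "card \<F> \<in> ?M" using \<F> by blast
  show "card \<F> \<le> max_nontrivial r n k"
    unfolding max_nontrivial_def by (rule Max_ge[OF fin mem])
  have "max_nontrivial r n k \<in> ?M"
    unfolding max_nontrivial_def by (rule Max_in[OF fin]) (use mem in blast)
  thus "max_nontrivial r n k < b" using less by auto
qed

theorem theorem12:
  fixes r :: nat and \<epsilon> \<delta> :: real
  assumes "r \<ge> 3" and "\<epsilon> > 0" and "\<delta> > 0"
  shows "\<exists>n0 :: nat. \<forall>n k :: nat.
           n > n0 \<and> (real r - 2) / (real r - 1) + \<epsilon> < real k / real n
             \<and> real k / real n < (real r - 1) / real r - \<epsilon> \<longrightarrow>
           (1 - \<delta>) * real ((n - 1) choose (k - 1)) \<le> real (max_nontrivial r n k)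
             \<and> max_nontrivial r n k < (n - 1) choose (k - 1)"
proof -
  \<comment> \<open>\<open>t \<ge> r\<close> serves non-triviality; the other bound keeps the
    Chebyshev loss for \<open>\<eta> = \<epsilon> / 2\<close> below \<open>\<delta>\<close>.\<close>
  define t where "t = max r (nat \<lceil>4 / (\<delta> * \<epsilon>\<^sup>2)\<rceil>)"
  \<comment> \<open>The first bound yields \<open>t < k\<close>; the second makes
    \<open>(n - 1) \<epsilon> > 2\<close>, which absorbs all rounding.\<close>
  define n0 where "n0 = max (2 * t + 4) (Suc (nat \<lceil>2 / \<epsilon>\<rceil>))"
  have t: "r \<le> t" "4 / (\<delta> * \<epsilon>\<^sup>2) \<le> real t"
    unfolding t_def by linarith+
  show ?thesis
  proof (intro exI[of _ n0] allI impI)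
    fix n k :: nat
    assume nk: "n > n0 \<and> (real r - 2) / (real r - 1) + \<epsilon> < real k / real n
             \<and> real k / real n < (real r - 1) / real r - \<epsilon>"
    have n: "2 * t + 4 < n" "2 / \<epsilon> + 1 < real n"
      using nk unfolding n0_def by linarith+
    have n_pos: "0 < real n" using n by simp
    have lower: "((real r - 2) / (real r - 1) + \<epsilon>) * real n < real k"
      using nk n_pos by (simp add: pos_less_divide_eq)
    have upper: "real k < ((real r - 1) / real r - \<epsilon>) * real n"
      using nk n_pos by (simp add: pos_divide_less_eq)
    have r: "3 \<le> real r" using assms(1) by simp
    have n\<epsilon>: "2 < (real n - 1) * \<epsilon>"
      using n(2) assms(2) by (simp add: pos_divide_less_eq[symmetric])
    have k: "t < k"
    proof -
      \<comment> \<open>Since \<open>r \<ge> 3\<close>, the lower density bound gives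
        \<open>k > n / 2\<close>.\<close>
      have "1 / 2 \<le> (real r - 2) / (real r - 1)" using r by (simp add: field_simps)
      hence "1 / 2 * real n \<le> ((real r - 2) / (real r - 1) + \<epsilon>) * real n"
        using assms(2) by (intro mult_right_mono) auto
      with lower n(1) show ?thesis by linarith
    qed
    have rk: "real r * real k < (real r - 1) * real n - real r * (real n * \<epsilon>)"
    proof -
      have "real r * real k < real r * (((real r - 1) / real r - \<epsilon>) * real n)"
        using upper r by (intro mult_strict_left_mono) auto
      also have "\<dots> = (real r - 1) * real n - real r * (real n * \<epsilon>)"
        using r by (simp add: field_simps)
      finally show ?thesis .
    qed
    \<comment> \<open>This slack pays for the \<open>-1\<close> in \<open>n - k - 1\<close> when
      \<open>r (n - k - 1) \<ge> n - 1\<close> is derived.\<close>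
    have "1 \<le> real n * \<epsilon>" using n\<epsilon> assms(2) by (simp add: algebra_simps)
    hence "real r * 1 \<le> real r * (real n * \<epsilon>)" using r by (intro mult_left_mono) auto
    with rk have rk': "real r * real k + real n + real r < real r * real n"
      by (simp add: algebra_simps)
    have "k < n"
    proof (rule ccontr)
      assume "\<not> k < n"
      hence "real r * real n \<le> real r * real k" using r by (intro mult_left_mono) auto
      with rk' n_pos r show False by linarith
    qed
    have cover: "n - 1 \<le> r * (n - k - 1)"
    proof -
      have "real (n - k - 1) = real n - real k - 1" using \<open>k < n\<close> by (simp add: of_nat_diff)
      hence "real (r * (n - k - 1)) = real r * real n - real r * real k - real r"
        by (simp only: of_nat_mult right_diff_distrib mult_1_right)
      with rk' have "real n < real (r * (n - k - 1))" by linarith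
      thus ?thesis by linarith
    qed
    \<comment> \<open>The lower bound on \<open>k / n\<close> gives
      \<open>(n - k) / n < 1 / (r - 1) - \<epsilon>\<close>; half of \<open>\<epsilon>\<close> is
      spent on replacing the denominator by \<open>n - 1\<close>.\<close>
    have density: "(real n - real k) / (real n - 1) + \<epsilon> / 2 \<le> 1 / (real r - 1)"
    proof -
      define a where "a = 1 / (real r - 1)"
      have a: "a \<le> 1" "(real r - 2) / (real r - 1) = 1 - a"
        using r by (simp_all add: a_def field_simps)
      from lower have "real n - real k \<le> (a - \<epsilon>) * real n"
        unfolding a(2) by (simp add: algebra_simps)
      also have "\<dots> = (a - \<epsilon>) * (real n - 1) + (a - \<epsilon>)"
        by (simp add: algebra_simps)
      also have "\<dots> \<le> (a - \<epsilon>) * (real n - 1) + \<epsilon> / 2 * (real n - 1)"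
      proof (rule add_left_mono)
        have "1 \<le> \<epsilon> / 2 * (real n - 1)" using n\<epsilon> by (simp add: mult.commute)
        with a(1) assms(2) show "a - \<epsilon> \<le> \<epsilon> / 2 * (real n - 1)" by linarith
      qed
      finally have "real n - real k \<le> (a - \<epsilon> / 2) * (real n - 1)"
        by (simp add: algebra_simps diff_divide_distrib)
      hence "(real n - real k) / (real n - 1) \<le> a - \<epsilon> / 2"
        using n(1) by (simp add: pos_divide_le_eq)
      thus ?thesis by (simp add: a_def)
    qed
    define T :: "nat set" where "T = {2..t+1}"
    define \<F> where "\<F> = threshold_family r 1 T {1..n} k"
    have T: "finite T" "T \<subseteq> {1..n} - {1}" "card T = t" "T \<noteq> {}"
      using n(1) t(1) assms(1) by (auto simp: T_def)
    have \<F>1: "\<F> \<subseteq> nsets {1..n} k" by (auto simp: \<F>_def threshold_family_def)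
    have \<F>2: "wise_intersecting r \<F>"
      unfolding \<F>_def using T assms(1) by (intro threshold_family_wise_intersecting) auto
    have \<F>3: "nontrivial_family \<F>"
      unfolding \<F>_def using T t(1) k \<open>k < n\<close> assms(1) by (intro threshold_family_nontrivial) auto
    have less: "card \<G> < (n - 1) choose (k - 1)"
      if "\<G> \<subseteq> nsets {1..n} k" "wise_intersecting r \<G>" "nontrivial_family \<G>" for \<G> :: "nat set set"
      using nontrivial_card_less[OF _ _ that] k \<open>k < n\<close> cover assms(1) by simp
    have max: "card \<F> \<le> max_nontrivial r n k" "max_nontrivial r n k < (n - 1) choose (k - 1)"
      by (rule max_nontrivial_bounds[OF less \<F>1 \<F>2 \<F>3]; assumption)+
    have "1 / (real t * (\<epsilon> / 2)\<^sup>2) \<le> \<delta>"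
    proof -
      have "0 < real t" using t(1) assms(1) by simp
      moreover have "4 \<le> real t * (\<delta> * \<epsilon>\<^sup>2)" using t(2) assms(2,3) by (simp add: pos_divide_le_eq)
      ultimately show ?thesis using assms(2) by (simp add: field_simps)
    qed
    hence "(1 - \<delta>) * real ((n - 1) choose (k - 1))
        \<le> (1 - 1 / (real t * (\<epsilon> / 2)\<^sup>2)) * real ((n - 1) choose (k - 1))"
      by (intro mult_right_mono) auto
    also have "\<dots> \<le> real (card \<F>)"
      unfolding \<F>_def T(3)[symmetric]
      using T n k \<open>k < n\<close> density assms by (intro card_threshold_family_ge) auto
    also have "\<dots> \<le> real (max_nontrivial r n k)" using max(1) by simp
    finally show "(1 - \<delta>) * real ((n - 1) choose (k - 1)) \<le> real (max_nontrivial r n k)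
        \<and> max_nontrivial r n k < (n - 1) choose (k - 1)"
      using max(2) by blast
  qed
qed

end
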